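(* Let $p$ be a prime, $\lambda$ a partition, and let $J\subset I'\subset I$ be ideals in $P_\lambda$. Then the order of the $G_{p,\lambda}$-orbit in $A_{p,I}/A_{p,J}$ corresponding to $I'$, namely the image of $O_{p,I'}$ in $A_{p,I}/A_{p,J}$, is $$\frac{\sum_{I''\cup J=I'}|O_{p,I''}|}{|A_{p,J}|},$$ where the sum is over all ideals $I''$ of $P_\lambda$ such that $I''\cup J=I'$.
   Context: A partition is a non-increasing sequence $\lambda=(\lambda_1\geq\cdots\geq\lambda_l)$ of positive integers. $A_{p,\lambda}=\mathbf{Z}/p^{\lambda_1}\mathbf{Z}\oplus\cdots\oplus\mathbf{Z}/p^{\lambda_l}\mathbf{Z}$ and $G_{p,\lambda}$ is its automorphism group. Fundamental poset $P$: its elements are the symbols $(p^r,k)$ with integers $0\leq r<k$, where $(p^r,k)$ stands for the orbit of $p^r$ in $\mathbf{Z}/p^k\mathbf{Z}$ under automorphisms of $\mathbf{Z}/p^k\mathbf{Z}$, i.e. the set of elements $p^ru$ with $p\nmid u$. The partial order is: $(p^r,k)\geq(p^s,l)$ if and only if $r\leq s$ and $k-r\geq l-s$ (equivalently, some homomorphism $\mathbf{Z}/p^k\mathbf{Z}\to\mathbf{Z}/p^l\mathbf{Z}$ maps $p^r$ to $p^s$). $P_\lambda$ is the induced subposet consisting of the elements $(p^r,k)$ with $k=\lambda_i$ for some $i$. An ideal of a poset is a (possibly empty) down-closed subset. For $a=(a_1,\ldots,a_l)\in A_{p,\lambda}$, $I(a)$ is the ideal of $P$ generated by the orbits of the non-zero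 coordinates $a_i\in\mathbf{Z}/p^{\lambda_i}\mathbf{Z}$ ($a_i=p^ru\neq0$ with $p\nmid u$ contributes $(p^r,\lambda_i)$), and $I_\lambda(a)=I(a)\cap P_\lambda$. For an ideal $I$ of $P_\lambda$: $A_{p,I}=\{a\in A_{p,\lambda}: I_\lambda(a)\subset I\}$, a subgroup of $A_{p,\lambda}$ invariant under $G_{p,\lambda}$; and $O_{p,I}=\{a\in A_{p,\lambda}: I_\lambda(a)=I\}$, which is the $G_{p,\lambda}$-orbit in $A_{p,\lambda}$ corresponding to $I$. For ideals $J\subset I$, $G_{p,\lambda}$ acts on the subquotient $A_{p,I}/A_{p,J}$ through its action on $A_{p,\lambda}$; the ideals $I'$ with $J\subset I'\subset I$ correspond bijectively to the $G_{p,\lambda}$-orbits in $A_{p,I}/A_{p,J}$, with $I'$ corresponding to the image of $O_{p,I'}$. *)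

theory Defs
  imports
    Complex_Main
    "HOL-Algebra.Group_Action"
    "HOL-Algebra.Product_Groups"
    "HOL-Algebra.Elementary_Groups"
    "HOL-Computational_Algebra.Primes"
    "HOL.Hull"
begin

definition is_partition :: "nat list \<Rightarrow> bool"
  where "is_partition lam \<longleftrightarrow> sorted_wrt (\<ge>) lam \<and> (\<forall>k\<in>set lam. 0 < k)"

(* Elements are the extensional functions on {..<length lam} whose i-th value is the
   representative in {0..<p ^ lam ! i} of a residue class. *)
definition abelian_p_group :: "nat \<Rightarrow> nat list \<Rightarrow> (nat \<Rightarrow> int) monoid"
  where "abelian_p_group p lam =
    product_group {..<length lam} (\<lambda>i. integer_mod_group (p ^ (lam ! i)))"

(* The pair (r, k) encodes the symbol (p^r, k), the orbit of p^r in Z/p^k;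
   the poset does not depend on p. *)
definition fund_poset :: "(nat \<times> nat) set"
  where "fund_poset = {(r, k). r < k}"

fun fund_le :: "nat \<times> nat \<Rightarrow> nat \<times> nat \<Rightarrow> bool"
  where "fund_le (s, l) (r, k) \<longleftrightarrow> r \<le> s \<and> l - s \<le> k - r"

definition fund_poset_of :: "nat list \<Rightarrow> (nat \<times> nat) set"
  where "fund_poset_of lam = {(r, k) \<in> fund_poset. k \<in> set lam}"

definition order_ideal :: "(nat \<times> nat) set \<Rightarrow> (nat \<times> nat) set \<Rightarrow> bool"
  where "order_ideal X I \<longleftrightarrow> I \<subseteq> X \<and> (\<forall>x\<in>I. \<forall>y\<in>X. fund_le y x \<longrightarrow> y \<in> I)"

definition coord_orbits :: "nat \<Rightarrow> nat list \<Rightarrow> (nat \<Rightarrow> int) \<Rightarrow> (nat \<times> nat) set"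
  where "coord_orbits p lam a =
    {(multiplicity (int p) (a i), lam ! i) | i. i < length lam \<and> a i \<noteq> 0}"

definition ideal_of :: "nat \<Rightarrow> nat list \<Rightarrow> (nat \<Rightarrow> int) \<Rightarrow> (nat \<times> nat) set"
  where "ideal_of p lam a = order_ideal fund_poset hull coord_orbits p lam a"

definition ideal_in_of :: "nat \<Rightarrow> nat list \<Rightarrow> (nat \<Rightarrow> int) \<Rightarrow> (nat \<times> nat) set"
  where "ideal_in_of p lam a = ideal_of p lam a \<inter> fund_poset_of lam"

definition char_subgroup :: "nat \<Rightarrow> nat list \<Rightarrow> (nat \<times> nat) set \<Rightarrow> (nat \<Rightarrow> int) set"
  where "char_subgroup p lam I =
    {a \<in> carrier (abelian_p_group p lam). ideal_in_of p lam a \<subseteq> I}"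

definition ideal_orbit :: "nat \<Rightarrow> nat list \<Rightarrow> (nat \<times> nat) set \<Rightarrow> (nat \<Rightarrow> int) set"
  where "ideal_orbit p lam I =
    {a \<in> carrier (abelian_p_group p lam). ideal_in_of p lam a = I}"

definition subquotient ::
  "nat \<Rightarrow> nat list \<Rightarrow> (nat \<times> nat) set \<Rightarrow> (nat \<times> nat) set \<Rightarrow> (nat \<Rightarrow> int) set monoid"
  where "subquotient p lam I J =
    (abelian_p_group p lam)\<lparr>carrier := char_subgroup p lam I\<rparr> Mod char_subgroup p lam J"

(* g sends the coset of a to the coset of g a, which is the image of the coset under g since
   char_subgroup p lam J is invariant; extensional, as BijGroup requires. *)
definition subquotient_action ::
  "nat \<Rightarrow> nat list \<Rightarrow> (nat \<times> nat) set \<Rightarrow> (nat \<times> nat) set \<Rightarrow>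
    ((nat \<Rightarrow> int) \<Rightarrow> (nat \<Rightarrow> int)) \<Rightarrow> (nat \<Rightarrow> int) set \<Rightarrow> (nat \<Rightarrow> int) set"
  where "subquotient_action p lam I J g = (\<lambda>C \<in> carrier (subquotient p lam I J). g ` C)"

definition subquotient_image ::
  "nat \<Rightarrow> nat list \<Rightarrow> (nat \<times> nat) set \<Rightarrow> (nat \<Rightarrow> int) set \<Rightarrow> (nat \<Rightarrow> int) set set"
  where "subquotient_image p lam J S =
    (\<lambda>a. char_subgroup p lam J #>\<^bsub>abelian_p_group p lam\<^esub> a) ` S"

end

theory Submission
  imports Defs "HOL-Number_Theory.Cong"
begin

text \<open>
  For an ideal \<open>I\<close> the subgroup \<open>A\<^sub>I\<close> is a product of subgroups \<open>p\<^sup>r(\<int>/p\<^sup>k)\<close>, one for each part \<open>k\<close>,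
  where \<open>(p\<^sup>r, k)\<close> is the largest element of \<open>I\<close> in column \<open>k\<close>. Endomorphisms preserve it, so
  automorphisms preserve the ideal of an element. Conversely, if \<open>a\<close> has ideal \<open>I\<close>, then each
  coordinate \<open>a\<^sub>i\<close> can be replaced by the generator \<open>p\<^sup>r\<close> of the \<open>i\<close>-th factor of \<open>A\<^sub>I\<close> by an elementary
  automorphism \<open>x\<^sub>i := u x\<^sub>i + m x\<^sub>j\<close>, because some coordinate \<open>a\<^sub>j\<close> dominates \<open>(p\<^sup>r, \<lambda>\<^sub>i)\<close>; hence the elements
  with ideal \<open>I\<close> form a single orbit.

  The preimage in \<open>A\<^sub>I\<close> of the image of \<open>O\<^sub>I\<^sub>'\<close> consists of the elements whose ideal \<open>I''\<close> satisfies
  \<open>I'' \<union> J = I'\<close>, and it is a union of cosets of \<open>A\<^sub>J\<close>.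
\<close>

section \<open>Ideals of the fundamental poset, column by column\<close>

lemma order_ideal_Un:
  "order_ideal X I \<Longrightarrow> order_ideal X J \<Longrightarrow> order_ideal X (I \<union> J)"
  unfolding order_ideal_def by blast

lemma finite_fund_poset_of: "finite (fund_poset_of lam)"
proof (rule finite_subset)
  show "fund_poset_of lam \<subseteq> (\<Union>k\<in>set lam. {..<k} \<times> {k})"
    by (auto simp: fund_poset_of_def fund_poset_def)
qed auto

lemma fund_le_trans:
  assumes "fund_le x y" "fund_le y z"
  shows "fund_le x z"
  using assms by (cases x; cases y; cases z) auto

lemma hull_fund_poset:
  assumes "S \<subseteq> fund_poset"
  shows "order_ideal fund_poset hull S = {x \<in> fund_poset. \<exists>y\<in>S. fund_le x y}"
proof (rule hull_unique)
  have "fund_le x x" for x by (cases x) auto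
  then show "S \<subseteq> {x \<in> fund_poset. \<exists>y\<in>S. fund_le x y}"
    using assms by blast
  show "order_ideal fund_poset {x \<in> fund_poset. \<exists>y\<in>S. fund_le x y}"
    unfolding order_ideal_def using fund_le_trans by blast
  show "{x \<in> fund_poset. \<exists>y\<in>S. fund_le x y} \<subseteq> T"
    if "S \<subseteq> T" "order_ideal fund_poset T" for T
    using that unfolding order_ideal_def by blast
qed

text \<open>The exponent of the largest element of an ideal among the symbols with second component
  \<open>k\<close>, or \<open>k\<close> if there is none: \<open>p ^ col_min I k\<close> generates the \<open>k\<close>-component of the
  subgroup belonging to \<open>I\<close>.\<close>

definition col_min :: "(nat \<times> nat) set \<Rightarrow> nat \<Rightarrow> nat"
  where "col_min I k = (LEAST r. r = k \<or> (r, k) \<in> I)"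

lemma col_min_le: "col_min I k \<le> k"
  unfolding col_min_def by (rule Least_le) simp

lemma col_min_in:
  assumes "col_min I k < k"
  shows "(col_min I k, k) \<in> I"
proof -
  have "col_min I k = k \<or> (col_min I k, k) \<in> I"
    unfolding col_min_def by (rule LeastI[where k = k]) simp
  with assms show ?thesis by simp
qed

text \<open>For fixed \<open>k\<close> the symbols \<open>(r, k)\<close> form a chain in which a
  larger \<open>r\<close> is lower, so down-closure makes each column of an ideal an interval of
  exponents.\<close>

lemma ideal_column_iff:
  assumes "order_ideal (fund_poset_of lam) I" "k \<in> set lam"
  shows "(r, k) \<in> I \<longleftrightarrow> col_min I k \<le> r \<and> r < k"
proof
  assume "(r, k) \<in> I"
  then show "col_min I k \<le> r \<and> r < k"
    using assms by (auto simp: col_min_def order_ideal_def fund_poset_of_def fund_poset_def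
        intro: Least_le)
next
  assume r: "col_min I k \<le> r \<and> r < k"
  then have "(col_min I k, k) \<in> I" by (intro col_min_in) simp
  moreover have "(r, k) \<in> fund_poset_of lam" "fund_le (r, k) (col_min I k, k)"
    using r assms by (auto simp: fund_poset_of_def fund_poset_def)
  ultimately show "(r, k) \<in> I"
    using assms(1) unfolding order_ideal_def by blast
qed

section \<open>Coordinates, valuations and the subgroups belonging to ideals\<close>

locale partition_p_group =
  fixes p :: nat and lam :: "nat list"
  assumes prime_p: "prime p"
begin

abbreviation "A \<equiv> abelian_p_group p lam"
abbreviation "P \<equiv> fund_poset_of lam"
abbreviation "q i \<equiv> int p ^ (lam ! i)"
abbreviation "val \<equiv> multiplicity (int p)"

lemma prime_int_p: "prime (int p)"
  using prime_p by simp

lemma p_pos [simp]: "0 < p"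
  using prime_p by (rule prime_gt_0_nat)

lemma p_pow_dvd_iff: "x \<noteq> 0 \<Longrightarrow> int p ^ n dvd x \<longleftrightarrow> n \<le> val x"
  using prime_int_p
  by (metis not_prime_unit power_dvd_iff_le_multiplicity)

lemma carrier_iff:
  "a \<in> carrier A \<longleftrightarrow> a \<in> extensional {..<length lam} \<and> (\<forall>i<length lam. 0 \<le> a i \<and> a i < q i)"
  using prime_gt_0_nat[OF prime_p]
  by (auto simp: abelian_p_group_def carrier_integer_mod_group PiE_iff)

lemma mult_A: "a \<otimes>\<^bsub>A\<^esub> b = (\<lambda>i\<in>{..<length lam}. (a i + b i) mod q i)"
  by (simp add: abelian_p_group_def)

lemma one_A: "\<one>\<^bsub>A\<^esub> = (\<lambda>i\<in>{..<length lam}. 0)"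
  by (simp add: abelian_p_group_def)

lemma group_A: "group A"
  by (simp add: abelian_p_group_def)

sublocale A: group A
  by (rule group_A)

lemma inv_A: "a \<in> carrier A \<Longrightarrow> inv\<^bsub>A\<^esub> a = (\<lambda>i\<in>{..<length lam}. - a i mod q i)"
  unfolding abelian_p_group_def by (auto simp: PiE_iff intro!: restrict_ext)

lemma pow_A:
  assumes "a \<in> carrier A"
  shows "a [^]\<^bsub>A\<^esub> (n::nat) = (\<lambda>i\<in>{..<length lam}. (int n * a i) mod q i)"
proof (induction n)
  case 0
  then show ?case by (auto simp: one_A)
next
  case (Suc n)
  then show ?case
    by (auto simp: fun_eq_iff mult_A mod_simps algebra_simps)
qed

lemma finite_carrier: "finite (carrier A)"
  using prime_gt_0_nat[OF prime_p]
  by (auto simp: abelian_p_group_def carrier_integer_mod_group intro!: finite_PiE)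

text \<open>A nonzero representative below \<open>q i\<close> is not divisible by
  \<open>q i\<close>; hence its integer valuation is that of its residue class.\<close>

lemma val_less: "a \<in> carrier A \<Longrightarrow> i < length lam \<Longrightarrow> a i \<noteq> 0 \<Longrightarrow> val (a i) < lam ! i"
  by (metis carrier_iff p_pow_dvd_iff linorder_not_less order_le_less zdvd_not_zless)

lemma coord_orbits_subset: "a \<in> carrier A \<Longrightarrow> coord_orbits p lam a \<subseteq> P"
  using val_less by (auto simp: coord_orbits_def fund_poset_of_def fund_poset_def)

lemma ideal_in_of_eq:
  assumes "a \<in> carrier A"
  shows "ideal_in_of p lam a = {x \<in> P. \<exists>y\<in>coord_orbits p lam a. fund_le x y}"
proof -
  have "P \<subseteq> fund_poset" by (auto simp: fund_poset_of_def)
  then show ?thesis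
    using hull_fund_poset[of "coord_orbits p lam a"] coord_orbits_subset[OF assms]
    unfolding ideal_in_of_def ideal_of_def by blast
qed

lemma order_ideal_in_of: "a \<in> carrier A \<Longrightarrow> order_ideal P (ideal_in_of p lam a)"
  unfolding order_ideal_def ideal_in_of_eq using fund_le_trans by blast

text \<open>It suffices to test the generators, and a symbol lies in \<open>I\<close> exactly when
  its exponent is at least \<open>col_min\<close>. In a column missing \<open>I\<close>,
  \<open>col_min\<close> is \<open>lam ! i\<close>, and divisibility forces the coordinate to
  vanish.\<close>

lemma ideal_in_of_subset_iff:
  assumes "a \<in> carrier A" "order_ideal P I"
  shows "ideal_in_of p lam a \<subseteq> I \<longleftrightarrow> (\<forall>i<length lam. int p ^ col_min I (lam ! i) dvd a i)"
proof -
  have refl: "fund_le x x" for x by (cases x) auto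
  have "ideal_in_of p lam a \<subseteq> I \<longleftrightarrow> coord_orbits p lam a \<subseteq> I"
    using coord_orbits_subset[OF assms(1)] assms(2) refl
    unfolding ideal_in_of_eq[OF assms(1)] order_ideal_def by blast
  also have "\<dots> \<longleftrightarrow> (\<forall>i<length lam. a i \<noteq> 0 \<longrightarrow> (val (a i), lam ! i) \<in> I)"
    by (auto simp: coord_orbits_def)
  also have "\<dots> \<longleftrightarrow> (\<forall>i<length lam. int p ^ col_min I (lam ! i) dvd a i)"
    using ideal_column_iff[OF assms(2)] val_less[OF assms(1)] p_pow_dvd_iff
    by (metis dvd_0_right nth_mem)
  finally show ?thesis .
qed

lemma char_subgroup_iff:
  assumes "order_ideal P I"
  shows "a \<in> char_subgroup p lam I \<longleftrightarrow>
    a \<in> carrier A \<and> (\<forall>i<length lam. int p ^ col_min I (lam ! i) dvd a i)"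
  using ideal_in_of_subset_iff[OF _ assms] by (auto simp: char_subgroup_def)

lemma col_min_dvd_mod: "int p ^ col_min I (lam ! i) dvd x mod q i \<longleftrightarrow> int p ^ col_min I (lam ! i) dvd x"
  by (simp add: dvd_mod_iff le_imp_power_dvd col_min_le)

lemma subgroup_char_subgroup:
  assumes "order_ideal P I"
  shows "subgroup (char_subgroup p lam I) A"
proof
  show "char_subgroup p lam I \<subseteq> carrier A" by (auto simp: char_subgroup_def)
  show "\<one>\<^bsub>A\<^esub> \<in> char_subgroup p lam I"
    using A.one_closed by (auto simp: char_subgroup_iff[OF assms] one_A)
  show "x \<otimes>\<^bsub>A\<^esub> y \<in> char_subgroup p lam I"
    if "x \<in> char_subgroup p lam I" "y \<in> char_subgroup p lam I" for x y
    using that A.m_closed[of x y] by (auto simp: char_subgroup_iff[OF assms] mult_A col_min_dvd_mod)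
  show "inv\<^bsub>A\<^esub> x \<in> char_subgroup p lam I" if "x \<in> char_subgroup p lam I" for x
    using that A.inv_closed[of x] by (auto simp: char_subgroup_iff[OF assms] inv_A col_min_dvd_mod)
qed

lemma ideal_orbit_subset: "ideal_orbit p lam I \<subseteq> char_subgroup p lam I"
  by (auto simp: ideal_orbit_def char_subgroup_def)

section \<open>Endomorphisms preserve the subgroups of ideals\<close>

definition coord :: "(nat \<Rightarrow> int) \<Rightarrow> nat \<Rightarrow> nat \<Rightarrow> int"
  where "coord a i = (\<lambda>j\<in>{..<length lam}. if j = i then a i else 0)"

text \<open>With \<open>v\<close> the valuation of a nonzero \<open>a i\<close>, the element
  \<open>coord a i\<close> is a \<open>p ^ v\<close>-th multiple and is killed by
  \<open>p ^ (lam ! i - v)\<close>. Its image inherits both properties, and these are the two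
  inequalities placing the symbols of the image below \<open>(v, lam ! i)\<close>.\<close>

lemma hom_coord_in_char_subgroup:
  assumes h: "h \<in> hom A A" and I: "order_ideal P I" and a: "a \<in> char_subgroup p lam I"
    and i: "i < length lam"
  shows "h (coord a i) \<in> char_subgroup p lam I"
proof (cases "a i = 0")
  case True
  then have "coord a i = \<one>\<^bsub>A\<^esub>" by (auto simp: coord_def one_A)
  then show ?thesis
    using h group_A subgroup_char_subgroup[OF I] by (simp add: hom_one subgroup.one_closed)
next
  case False
  define v where "v = val (a i)"
  define w where "w = a i div int p ^ v"
  define e where "e = (\<lambda>j\<in>{..<length lam}. if j = i then w else 0)"
  have ca: "a \<in> carrier A" using a by (simp add: char_subgroup_def)
  have v: "v < lam ! i" using val_less ca i False by (simp add: v_def)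
  have pv: "0 < int p ^ v" by simp
  have aw: "a i = int p ^ v * w" by (simp add: w_def v_def multiplicity_dvd)
  have ai: "0 \<le> a i" "a i < q i" using ca i by (auto simp: carrier_iff)
  have w: "0 \<le> w" "w < q i"
  proof -
    show "0 \<le> w" using ai pv by (simp add: w_def pos_imp_zdiv_nonneg_iff)
    then have "1 * w \<le> int p ^ v * w" by (intro mult_right_mono) (use pv in linarith)+
    then show "w < q i" using ai aw by simp
  qed
  have ce: "e \<in> carrier A" using w by (auto simp: carrier_iff e_def)
  have cc: "coord a i \<in> carrier A" using ai by (auto simp: carrier_iff coord_def)
  have hc: "h (coord a i) \<in> carrier A" "h e \<in> carrier A" using h cc ce by (auto simp: hom_def)
  have "coord a i = e [^]\<^bsub>A\<^esub> (p ^ v)"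
    unfolding pow_A[OF ce] using aw ai by (auto simp: coord_def e_def intro!: restrict_ext)
  then have 1: "h (coord a i) = h e [^]\<^bsub>A\<^esub> (p ^ v)"
    using hom_nat_pow[OF h ce group_A group_A] by simp
  have "coord a i [^]\<^bsub>A\<^esub> (p ^ (lam ! i - v)) = \<one>\<^bsub>A\<^esub>"
  proof -
    have "int p ^ (lam ! i - v) * a i = q i * w"
      using v by (simp add: aw flip: power_add mult.assoc)
    then show ?thesis
      unfolding pow_A[OF cc] by (auto simp: coord_def one_A intro!: restrict_ext)
  qed
  then have 2: "h (coord a i) [^]\<^bsub>A\<^esub> (p ^ (lam ! i - v)) = \<one>\<^bsub>A\<^esub>"
    using hom_nat_pow[OF h cc group_A group_A] h group_A by (metis hom_one)
  have "(v, lam ! i) \<in> I"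
    using a I i v by (simp add: char_subgroup_iff ideal_column_iff v_def flip: p_pow_dvd_iff[OF False])
  have "int p ^ col_min I (lam ! j) dvd h (coord a i) j" if j: "j < length lam" for j
  proof (cases "h (coord a i) j = 0")
    case False
    define s where "s = val (h (coord a i) j)"
    have s: "s < lam ! j" using val_less[OF hc(1) j False] by (simp add: s_def)
    have "h (coord a i) j = (int p ^ v * h e j) mod q j"
      using j by (simp add: 1 pow_A[OF hc(2)])
    moreover have "int p ^ min v (lam ! j) dvd (int p ^ v * h e j) mod q j"
      by (simp add: dvd_mod le_imp_power_dvd)
    \<comment> \<open>The coordinate is known only modulo \<open>q j\<close>, hence the minimum;
      \<open>s < lam ! j\<close> then excludes its second value.\<close>
    ultimately have "min v (lam ! j) \<le> s"
      using p_pow_dvd_iff[OF False] by (simp add: s_def)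
    then have vs: "v \<le> s" using s by simp
    have "(int p ^ (lam ! i - v) * h (coord a i) j) mod q j = 0"
      using fun_cong[OF 2, of j] j by (simp add: pow_A[OF hc(1)] one_A)
    then have "q j dvd int p ^ (lam ! i - v) * h (coord a i) j" by auto
    then have "lam ! j \<le> val (int p ^ (lam ! i - v) * h (coord a i) j)"
      using False prime_gt_0_nat[OF prime_p] by (subst (asm) p_pow_dvd_iff) auto
    also have "\<dots> = (lam ! i - v) + s"
      using False prime_int_p
      by (simp add: s_def prime_elem_multiplicity_mult_distrib prime_elem_multiplicity_power_distrib)
    finally have "fund_le (s, lam ! j) (v, lam ! i)" using vs v s by auto
    moreover have "(s, lam ! j) \<in> P" using s j by (auto simp: fund_poset_of_def fund_poset_def)
    ultimately have "(s, lam ! j) \<in> I"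
      using I \<open>(v, lam ! i) \<in> I\<close> unfolding order_ideal_def by blast
    then show ?thesis
      using I j p_pow_dvd_iff[OF False] by (simp add: ideal_column_iff s_def)
  qed simp
  then show ?thesis using hc I by (simp add: char_subgroup_iff)
qed

text \<open>The truncations \<open>t n\<close> build \<open>a\<close> up one coordinate at a time,
  so the case of a single coordinate and closure under the group operation suffice.\<close>

lemma hom_char_subgroup:
  assumes h: "h \<in> hom A A" and I: "order_ideal P I" and a: "a \<in> char_subgroup p lam I"
  shows "h a \<in> char_subgroup p lam I"
proof -
  define t where "t n = (\<lambda>j\<in>{..<length lam}. if j < n then a j else 0)" for n
  have ca: "a \<in> carrier A" using a by (simp add: char_subgroup_def)
  have ct: "t n \<in> carrier A" for n using ca by (auto simp: t_def carrier_iff)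
  have "h (t n) \<in> char_subgroup p lam I" if "n \<le> length lam" for n
    using that
  proof (induction n)
    case 0
    have "t 0 = \<one>\<^bsub>A\<^esub>" by (auto simp: t_def one_A)
    then show ?case
      using h group_A subgroup_char_subgroup[OF I] by (simp add: hom_one subgroup.one_closed)
  next
    case (Suc n)
    have cc: "coord a n \<in> carrier A" using ca by (auto simp: carrier_iff coord_def)
    have "t (Suc n) = t n \<otimes>\<^bsub>A\<^esub> coord a n"
      using ca by (auto simp: t_def coord_def mult_A carrier_iff less_Suc_eq intro!: restrict_ext)
    then have "h (t (Suc n)) = h (t n) \<otimes>\<^bsub>A\<^esub> h (coord a n)"
      using h ct cc by (simp add: hom_mult)
    moreover have "h (coord a n) \<in> char_subgroup p lam I"
      using hom_coord_in_char_subgroup[OF h I a] Suc.prems by simp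
    ultimately show ?case
      using Suc subgroup.m_closed[OF subgroup_char_subgroup[OF I]] by simp
  qed
  from this[of "length lam"] have "h (t (length lam)) \<in> char_subgroup p lam I" by simp
  moreover have "t (length lam) = a"
    using ca by (auto simp: t_def carrier_iff intro!: extensionalityI[where A = "{..<length lam}"])
  ultimately show ?thesis by simp
qed

text \<open>Every element lies in the subgroup of its own ideal, and the endomorphism
  \<open>g\<close> preserves that subgroup.\<close>

lemma auto_ideal_in_of_subset:
  assumes "g \<in> auto A" "a \<in> carrier A"
  shows "ideal_in_of p lam (g a) \<subseteq> ideal_in_of p lam a"
  using hom_char_subgroup[of g "ideal_in_of p lam a" a] assms order_ideal_in_of
  by (auto simp: auto_def char_subgroup_def)

lemma auto_carrier: "g \<in> auto A \<Longrightarrow> a \<in> carrier A \<Longrightarrow> g a \<in> carrier A"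
  by (auto simp: auto_def hom_def)

lemma auto_inverse:
  assumes "g \<in> auto A"
  obtains g' where "g' \<in> auto A" "\<And>a. a \<in> carrier A \<Longrightarrow> g' (g a) = a"
    "\<And>a. a \<in> carrier A \<Longrightarrow> g (g' a) = a"
proof
  let ?g' = "restrict (inv_into (carrier A) g) (carrier A)"
  show "?g' \<in> auto A"
    using assms A.restrict_inv_into_hom restrict_inv_into_Bij by (auto simp: auto_def)
  have "bij_betw g (carrier A) (carrier A)" using assms by (auto simp: auto_def Bij_def)
  then show "?g' (g a) = a" "g (?g' a) = a" if "a \<in> carrier A" for a
    using that auto_carrier[OF assms that]
    by (auto simp: bij_betw_inv_into_left bij_betw_inv_into_right)
qed

lemma auto_ideal_in_of:
  assumes "g \<in> auto A" "a \<in> carrier A"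
  shows "ideal_in_of p lam (g a) = ideal_in_of p lam a"
proof -
  obtain g' where "g' \<in> auto A" "g' (g a) = a"
    using auto_inverse[OF assms(1)] assms(2) by metis
  then show ?thesis
    using auto_ideal_in_of_subset[of g' "g a"] auto_ideal_in_of_subset[of g a] assms auto_carrier
    by auto
qed

section \<open>Transitivity on the elements with a given ideal\<close>

definition autom_equiv :: "(nat \<Rightarrow> int) \<Rightarrow> (nat \<Rightarrow> int) \<Rightarrow> bool"
  where "autom_equiv a b \<longleftrightarrow> a \<in> carrier A \<and> (\<exists>g\<in>auto A. g a = b)"

lemma autom_equiv_carrier: "autom_equiv a b \<Longrightarrow> a \<in> carrier A \<and> b \<in> carrier A"
  using auto_carrier by (auto simp: autom_equiv_def)

lemma autom_equiv_ideal: "autom_equiv a b \<Longrightarrow> ideal_in_of p lam b = ideal_in_of p lam a"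
  using auto_ideal_in_of by (auto simp: autom_equiv_def)

lemma autom_equiv_refl: "a \<in> carrier A \<Longrightarrow> autom_equiv a a"
  unfolding autom_equiv_def using A.id_in_auto by (intro conjI bexI[of _ "\<lambda>x\<in>carrier A. x"]) auto

lemma autom_equiv_sym: "autom_equiv a b \<Longrightarrow> autom_equiv b a"
  by (metis autom_equiv_def auto_inverse auto_carrier)

lemma autom_equiv_trans:
  assumes "autom_equiv a b" "autom_equiv b c"
  shows "autom_equiv a c"
proof -
  obtain g h where gh: "g \<in> auto A" "h \<in> auto A" "g a = b" "h b = c" and a: "a \<in> carrier A"
    using assms by (auto simp: autom_equiv_def)
  have "compose (carrier A) h g \<in> auto A"
    using gh A.hom_compose compose_Bij by (auto simp: auto_def)
  moreover have "compose (carrier A) h g a = c" using gh a by (simp add: compose_def)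
  ultimately show ?thesis using a by (auto simp: autom_equiv_def)
qed

text \<open>The condition on \<open>m * q j\<close> makes multiplication by \<open>m\<close> well
  defined from the \<open>j\<close>-th to the \<open>i\<close>-th factor. The unit \<open>u\<close>
  gives injectivity, and finiteness then gives bijectivity. The case \<open>m = 0\<close> covers
  rescaling one coordinate.\<close>

lemma elementary_autom:
  assumes i: "i < length lam" and j: "j < length lam"
    and m: "q i dvd m * q j" "m = 0 \<or> j \<noteq> i" and u: "coprime u (int p)"
    and a: "a \<in> carrier A"
  shows "autom_equiv a (a(i := (u * a i + m * a j) mod q i))"
proof -
  define g where "g = (\<lambda>x\<in>carrier A. x(i := (u * x i + m * x j) mod q i))"
  have gc: "g x \<in> carrier A" if "x \<in> carrier A" for x
    using that i by (auto simp: g_def carrier_iff extensional_def)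
  have mj: "[m * (x mod q j) = m * x] (mod q i)" for x
  proof -
    have "m * x - m * (x mod q j) = m * q j * (x div q j)"
      by (simp add: algebra_simps flip: minus_mod_eq_mult_div)
    then have "q i dvd m * x - m * (x mod q j)"
      using m(1) by simp
    then show ?thesis by (simp add: cong_iff_dvd_diff dvd_diff_commute)
  qed
  have "g (x \<otimes>\<^bsub>A\<^esub> y) = g x \<otimes>\<^bsub>A\<^esub> g y" if "x \<in> carrier A" "y \<in> carrier A" for x y
  proof -
    have "[u * ((x i + y i) mod q i) + m * ((x j + y j) mod q j) =
      u * (x i + y i) + m * (x j + y j)] (mod q i)"
      by (intro cong_add mj cong_scalar_left) (simp add: cong_def)
    also have "u * (x i + y i) + m * (x j + y j) = (u * x i + m * x j) + (u * y i + m * y j)"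
      by (simp add: algebra_simps)
    finally show ?thesis
      using that i j A.m_closed[OF that]
      by (auto simp: g_def fun_eq_iff mult_A cong_def mod_simps)
  qed
  then have hom: "g \<in> hom A A" using gc by (simp add: hom_def)
  have "inj_on g (carrier A)"
  proof (rule inj_onI)
    fix x y assume xy: "x \<in> carrier A" "y \<in> carrier A" "g x = g y"
    have other: "x k = y k" if "k \<noteq> i" for k
      using fun_cong[OF xy(3), of k] xy(1,2) that by (simp add: g_def)
    have "m * x j = m * y j" using m(2) other by auto
    moreover have "(u * x i + m * x j) mod q i = (u * y i + m * y j) mod q i"
      using fun_cong[OF xy(3), of i] xy(1,2) by (simp add: g_def)
    ultimately have "[u * x i + m * x j = u * y i + m * x j] (mod q i)"
      unfolding cong_def by metis
    then have "[x i * u = y i * u] (mod q i)"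
      by (simp add: cong_add_rcancel mult.commute)
    then have "[x i = y i] (mod q i)"
      using u by (subst (asm) cong_mult_rcancel) auto
    then have "x i = y i" using xy i by (auto simp: carrier_iff cong_def)
    with other show "x = y" by (metis ext)
  qed
  moreover have "g ` carrier A \<subseteq> carrier A" using gc by auto
  ultimately have "bij_betw g (carrier A) (carrier A)"
    by (simp add: bij_betw_def endo_inj_surj finite_carrier)
  then have "g \<in> auto A" using hom by (simp add: auto_def Bij_def g_def)
  then show ?thesis using a by (auto simp: autom_equiv_def g_def intro!: bexI[of _ g])
qed

text \<open>The reduction modulo \<open>q i\<close> turns the default exponent
  \<open>lam ! i\<close> of a column missing \<open>I\<close> into the coordinate 0.\<close>

definition canonical :: "(nat \<times> nat) set \<Rightarrow> nat \<Rightarrow> int"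
  where "canonical I = (\<lambda>i\<in>{..<length lam}. int p ^ col_min I (lam ! i) mod q i)"

lemma canonical_carrier: "canonical I \<in> carrier A"
  by (auto simp: canonical_def carrier_iff)

lemma unit_part:
  fixes x :: int
  assumes "x \<noteq> 0"
  obtains u u' where "x = int p ^ val x * u" "coprime u (int p)" "coprime u' (int p)"
    "[u' * u = 1] (mod q i)"
proof -
  obtain u where u: "x = int p ^ val x * u" "\<not> int p dvd u"
    using multiplicity_decompose'[OF assms] prime_int_p not_prime_unit by metis
  have c: "coprime u (int p)"
    using u(2) prime_int_p by (metis coprime_commute prime_imp_coprime)
  \<comment> \<open>The exponent is raised by one so that \<open>int p\<close> divides the modulus
    whatever \<open>lam ! i\<close> is; this yields that \<open>u'\<close> is prime to
    \<open>p\<close>.\<close>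
  obtain u' where u': "[u * u' = 1] (mod int p ^ Suc (lam ! i))"
    using cong_solve_coprime_int[of u "int p ^ Suc (lam ! i)"] c by (metis coprime_power_right_iff)
  have "[u * u' = 1] (mod q i)"
    using u' by (rule cong_dvd_modulus) simp
  moreover have "[u * u' = 1] (mod int p)"
    using u' by (rule cong_dvd_modulus) simp
  then have "coprime u' (int p)"
    by (metis cong_imp_coprime cong_sym coprime_1_left coprime_mult_left_iff)
  ultimately show ?thesis using that u c by (simp add: mult.commute)
qed

lemma canonical_step:
  assumes a: "a \<in> ideal_orbit p lam I" and I: "order_ideal P I" and i: "i < length lam"
  shows "autom_equiv a (a(i := canonical I i))"
proof -
  define r where "r = col_min I (lam ! i)"
  have ca: "a \<in> carrier A" and Ia: "ideal_in_of p lam a = I"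
    using a by (auto simp: ideal_orbit_def)
  have dvd: "int p ^ r dvd a i"
    using subsetD[OF ideal_orbit_subset a] I i by (auto simp: char_subgroup_iff r_def)
  have ci: "canonical I i = int p ^ r mod q i" using i by (simp add: canonical_def r_def)
  have ai: "a i mod q i = a i" using ca i by (simp add: carrier_iff)
  show ?thesis
  proof (cases "r = lam ! i")
    case True
    then have "a i = 0" using dvd ai by auto
    then have "a(i := canonical I i) = a" using True ci by (auto simp: fun_eq_iff)
    then show ?thesis using autom_equiv_refl[OF ca] by simp
  next
    case False
    then have r: "r < lam ! i" using col_min_le[of I "lam ! i"] by (simp add: r_def)
    then have "(r, lam ! i) \<in> I" using col_min_in unfolding r_def by blast
    \<comment> \<open>Some coordinate \<open>a j\<close> must dominate the top of column
      \<open>lam ! i\<close>; it serves to correct \<open>a i\<close>.\<close>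
    then have "\<exists>y\<in>coord_orbits p lam a. fund_le (r, lam ! i) y"
      using Ia ideal_in_of_eq[OF ca] by blast
    then obtain j where j: "j < length lam" "a j \<noteq> 0" "val (a j) \<le> r"
      "lam ! i - r \<le> lam ! j - val (a j)"
      by (auto simp: coord_orbits_def)
    obtain u u' where u: "a j = int p ^ val (a j) * u" "coprime u' (int p)" "[u' * u = 1] (mod q i)"
      using unit_part[OF j(2)] by metis
    show ?thesis
    proof (cases "j = i")
      case True
      \<comment> \<open>Here \<open>a i\<close> is a unit times \<open>p ^ r\<close>, so rescaling
        by the inverse unit is enough.\<close>
      then have "val (a j) = r" using j dvd p_pow_dvd_iff by force
      then have "u' * a i = int p ^ r * (u' * u)" using u(1) True by (simp add: mult_ac)
      moreover have "[int p ^ r * (u' * u) = int p ^ r * 1] (mod q i)"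
        using u(3) by (rule cong_scalar_left)
      ultimately have "[u' * a i = int p ^ r] (mod q i)" by (simp only: mult_1_right)
      then have "(u' * a i + 0 * a i) mod q i = canonical I i" by (simp add: ci cong_def)
      then show ?thesis using elementary_autom[OF i i, of 0 u' a] u ca by simp
    next
      case False
      obtain d where d: "a i = int p ^ r * d" using dvd by auto
      \<comment> \<open>Chosen so that \<open>m * a j\<close> is congruent to
        \<open>p ^ r * (1 - d)\<close>, which is what \<open>a i = p ^ r * d\<close> lacks to be
        \<open>p ^ r\<close>.\<close>
      define m where "m = int p ^ (r - val (a j)) * (1 - d) * u'"
      have "m * a j = int p ^ r * (1 - d) * (u' * u)"
      proof -
        have "m * a j = (int p ^ (r - val (a j)) * int p ^ val (a j)) * (1 - d) * (u' * u)"
          by (subst u(1)) (simp add: m_def mult_ac)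
        then show ?thesis using j by (simp flip: power_add)
      qed
      moreover have "[int p ^ r * (1 - d) * (u' * u) = int p ^ r * (1 - d) * 1] (mod q i)"
        using u(3) by (rule cong_scalar_left)
      ultimately have "[a i + m * a j = a i + int p ^ r * (1 - d)] (mod q i)"
        by (simp add: cong_add_lcancel)
      also have "a i + int p ^ r * (1 - d) = int p ^ r" by (simp add: d algebra_simps)
      finally have "(1 * a i + m * a j) mod q i = canonical I i" by (simp add: ci cong_def)
      moreover have "q i dvd m * q j"
      proof -
        have "m * q j = int p ^ (r - val (a j) + lam ! j) * ((1 - d) * u')"
          by (simp add: m_def power_add mult_ac)
        \<comment> \<open>This is the second inequality of the domination,
          \<open>lam ! i - r \<le> lam ! j - val (a j)\<close>.\<close>
        moreover have "q i dvd int p ^ (r - val (a j) + lam ! j)"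
          using j r by (intro le_imp_power_dvd) linarith
        ultimately show ?thesis by simp
      qed
      ultimately show ?thesis
        using elementary_autom[OF i j(1), of m 1 a] False ca by simp
    qed
  qed
qed

text \<open>Coordinates are replaced one after another; each replacement is an automorphism, so the
  ideal remains \<open>I\<close> and the next replacement is possible.\<close>

lemma autom_equiv_canonical:
  assumes a: "a \<in> ideal_orbit p lam I" and I: "order_ideal P I"
  shows "autom_equiv a (canonical I)"
proof -
  have ca: "a \<in> carrier A" using a by (auto simp: ideal_orbit_def)
  have "autom_equiv a (\<lambda>i. if i < n then canonical I i else a i)" if "n \<le> length lam" for n
    using that
  proof (induction n)
    case 0
    then show ?case using autom_equiv_refl ca by simp
  next
    case (Suc n)
    let ?b = "\<lambda>i. if i < n then canonical I i else a i"
    have ab: "autom_equiv a ?b" using Suc by simp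
    then have "?b \<in> ideal_orbit p lam I"
      using autom_equiv_carrier autom_equiv_ideal a by (auto simp: ideal_orbit_def)
    then have "autom_equiv ?b (?b(n := canonical I n))"
      using canonical_step I Suc.prems by simp
    moreover have "?b(n := canonical I n) = (\<lambda>i. if i < Suc n then canonical I i else a i)"
      by (auto simp: fun_eq_iff less_Suc_eq)
    ultimately show ?case using autom_equiv_trans ab by metis
  qed
  from this[of "length lam"] have "autom_equiv a (\<lambda>i. if i < length lam then canonical I i else a i)"
    by simp
  moreover have "(\<lambda>i. if i < length lam then canonical I i else a i) = canonical I"
    using ca by (auto simp: fun_eq_iff carrier_iff canonical_def extensional_def)
  ultimately show ?thesis by simp
qed

lemma ideal_orbit_transitive:
  assumes "a \<in> ideal_orbit p lam I" "b \<in> ideal_orbit p lam I" "order_ideal P I"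
  shows "autom_equiv a b"
  using assms autom_equiv_canonical autom_equiv_sym autom_equiv_trans by blast

text \<open>Each element of \<open>I\<close> lies below the top of its column, so only these tops
  must be dominated by coordinates of \<open>a\<close>.\<close>

lemma ideal_orbitI:
  assumes a: "a \<in> char_subgroup p lam I" and I: "order_ideal P I"
    and gen: "\<And>i. i < length lam \<Longrightarrow> (col_min I (lam ! i), lam ! i) \<in> I \<Longrightarrow>
      \<exists>y\<in>coord_orbits p lam a. fund_le (col_min I (lam ! i), lam ! i) y"
  shows "a \<in> ideal_orbit p lam I"
proof -
  have ca: "a \<in> carrier A" using a by (simp add: char_subgroup_def)
  have "x \<in> ideal_in_of p lam a" if x: "x \<in> I" for x
  proof -
    have xP: "x \<in> P" using x I by (auto simp: order_ideal_def)
    then obtain s i where si: "x = (s, lam ! i)" "i < length lam"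
      by (auto simp: fund_poset_of_def in_set_conv_nth)
    let ?y = "(col_min I (lam ! i), lam ! i)"
    have "col_min I (lam ! i) \<le> s" "s < lam ! i"
      using x si I by (auto simp: ideal_column_iff)
    then have "?y \<in> I" "fund_le x ?y" using si I by (auto intro: col_min_in)
    then show ?thesis
      using gen[OF si(2)] xP fund_le_trans ideal_in_of_eq[OF ca] by blast
  qed
  then show ?thesis using a by (auto simp: ideal_orbit_def char_subgroup_def)
qed

lemma canonical_in_coord_orbits:
  assumes "i < length lam" "order_ideal P I" "(col_min I (lam ! i), lam ! i) \<in> I"
    "a i = canonical I i"
  shows "(col_min I (lam ! i), lam ! i) \<in> coord_orbits p lam a"
proof -
  have "col_min I (lam ! i) < lam ! i" using assms by (simp add: ideal_column_iff)
  then have "int p ^ col_min I (lam ! i) < q i"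
    using prime_gt_1_nat[OF prime_p] by simp
  then have "a i = int p ^ col_min I (lam ! i)" using assms by (simp add: canonical_def)
  then have "val (a i) = col_min I (lam ! i)" "a i \<noteq> 0"
    using prime_int_p by auto
  then show ?thesis
    using assms(1) unfolding coord_orbits_def by force
qed

lemma canonical_in_char_subgroup:
  assumes "order_ideal P I"
  shows "canonical I \<in> char_subgroup p lam I"
  using assms by (auto simp: char_subgroup_iff canonical_carrier) (simp add: canonical_def col_min_dvd_mod)

lemma canonical_in_ideal_orbit:
  assumes "order_ideal P I"
  shows "canonical I \<in> ideal_orbit p lam I"
proof (rule ideal_orbitI[OF canonical_in_char_subgroup[OF assms] assms])
  fix i assume "i < length lam" "(col_min I (lam ! i), lam ! i) \<in> I"
  then show "\<exists>y\<in>coord_orbits p lam (canonical I). fund_le (col_min I (lam ! i), lam ! i) y"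
    using canonical_in_coord_orbits[OF _ assms] by force
qed

section \<open>The preimage of the image of an orbit, and its size\<close>

lemma Union_subquotient_image:
  assumes J: "order_ideal P J" and I': "order_ideal P I'" and JI': "J \<subseteq> I'"
  shows "\<Union> (subquotient_image p lam J (ideal_orbit p lam I')) =
    (\<Union>I''\<in>{I''. order_ideal P I'' \<and> I'' \<union> J = I'}. ideal_orbit p lam I'')"
proof (intro equalityI subsetI)
  fix b assume "b \<in> \<Union> (subquotient_image p lam J (ideal_orbit p lam I'))"
  then obtain a j where aj: "a \<in> ideal_orbit p lam I'" "j \<in> char_subgroup p lam J" "b = j \<otimes>\<^bsub>A\<^esub> a"
    by (auto simp: subquotient_image_def r_coset_def)
  have c: "a \<in> carrier A" "j \<in> carrier A" and Ia: "ideal_in_of p lam a = I'"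
    using aj by (auto simp: ideal_orbit_def char_subgroup_def)
  then have b: "b \<in> carrier A" using aj by simp
  \<comment> \<open>Both \<open>j\<close> and \<open>b\<close> lie in the subgroup of
    \<open>?K\<close>, hence so does \<open>a\<close>, which gives
    \<open>I' \<subseteq> ?K\<close>.\<close>
  let ?K = "ideal_in_of p lam b \<union> J"
  have K: "order_ideal P ?K" using order_ideal_Un order_ideal_in_of b J by blast
  have "j \<in> char_subgroup p lam I'" using aj(2) JI' by (auto simp: char_subgroup_def)
  then have "b \<in> char_subgroup p lam I'"
    using aj ideal_orbit_subset subgroup.m_closed[OF subgroup_char_subgroup[OF I']] by blast
  then have "?K \<subseteq> I'" using JI' by (auto simp: char_subgroup_def)
  moreover have "inv\<^bsub>A\<^esub> j \<otimes>\<^bsub>A\<^esub> b \<in> char_subgroup p lam ?K"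
  proof -
    have "j \<in> char_subgroup p lam ?K" "b \<in> char_subgroup p lam ?K"
      using aj(2) b by (auto simp: char_subgroup_def)
    then show ?thesis
      using subgroup_char_subgroup[OF K] by (simp add: subgroup.m_closed subgroup.m_inv_closed)
  qed
  then have "a \<in> char_subgroup p lam ?K"
    using A.inv_solve_left[of a j b] aj c b by simp
  then have "I' \<subseteq> ?K" using Ia by (auto simp: char_subgroup_def)
  ultimately have "?K = I'" by (rule equalityI)
  then show "b \<in> (\<Union>I''\<in>{I''. order_ideal P I'' \<and> I'' \<union> J = I'}. ideal_orbit p lam I'')"
    using b order_ideal_in_of by (auto simp: ideal_orbit_def)
next
  fix b assume "b \<in> (\<Union>I''\<in>{I''. order_ideal P I'' \<and> I'' \<union> J = I'}. ideal_orbit p lam I'')"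
  then have b: "b \<in> carrier A" and bJ: "ideal_in_of p lam b \<union> J = I'"
    by (auto simp: ideal_orbit_def)
  let ?top = "\<lambda>i. (col_min I' (lam ! i), lam ! i)"
  \<comment> \<open>A representative of the coset of \<open>b\<close> with ideal exactly
    \<open>I'\<close>. Coordinates change only in columns whose top in \<open>I'\<close> belongs to
    \<open>J\<close>; there the old and the new value differ by something allowed in the subgroup of
    \<open>J\<close>.\<close>
  define a where "a = (\<lambda>i\<in>{..<length lam}. if ?top i \<in> J then canonical I' i else b i)"
  define j where "j = (\<lambda>i\<in>{..<length lam}. (b i - a i) mod q i)"
  have ca: "a \<in> carrier A" using b canonical_carrier by (auto simp: a_def carrier_iff)
  have cj: "j \<in> carrier A" by (auto simp: j_def carrier_iff)
  have bI': "b \<in> char_subgroup p lam I'" using b bJ by (auto simp: char_subgroup_def)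
  have aI': "a \<in> char_subgroup p lam I'"
    using ca bI' canonical_in_char_subgroup[OF I'] I' by (auto simp: char_subgroup_iff a_def)
  have "a \<in> ideal_orbit p lam I'"
  proof (rule ideal_orbitI[OF aI' I'])
    fix i assume i: "i < length lam" "?top i \<in> I'"
    show "\<exists>y\<in>coord_orbits p lam a. fund_le (?top i) y"
    proof (cases "?top i \<in> J")
      case True
      then have "?top i \<in> coord_orbits p lam a"
        using canonical_in_coord_orbits[OF i(1) I' i(2)] i(1) by (simp add: a_def)
      then show ?thesis by force
    next
      case False
      then have "?top i \<in> ideal_in_of p lam b" using i bJ by blast
      then obtain k where k: "k < length lam" "b k \<noteq> 0"
        "fund_le (?top i) (val (b k), lam ! k)"
        unfolding ideal_in_of_eq[OF b] by (auto simp: coord_orbits_def)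
      \<comment> \<open>Otherwise \<open>J\<close> would contain the symbol of \<open>b k\<close>
        and thus \<open>?top i\<close>. So the dominating coordinate \<open>b k\<close> survives in
        \<open>a\<close>.\<close>
      have "?top k \<notin> J"
      proof
        assume "?top k \<in> J"
        moreover have "int p ^ col_min I' (lam ! k) dvd b k" "val (b k) < lam ! k"
          using bI' I' k val_less[OF b] by (auto simp: char_subgroup_iff)
        ultimately have "(val (b k), lam ! k) \<in> J"
          using J k p_pow_dvd_iff by (auto simp: ideal_column_iff)
        then have "?top i \<in> J"
          using k(3) J i(2) I' unfolding order_ideal_def by blast
        with False show False by simp
      qed
      then have "(val (b k), lam ! k) \<in> coord_orbits p lam a"
        using k by (auto simp: coord_orbits_def a_def)
      then show ?thesis using k(3) by blast
    qed
  qed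
  moreover have "j \<in> char_subgroup p lam J"
  proof -
    have "int p ^ col_min J (lam ! i) dvd j i" if i: "i < length lam" for i
    proof (cases "?top i \<in> J")
      case True
      then have "col_min J (lam ! i) \<le> col_min I' (lam ! i)"
        using J i by (simp add: ideal_column_iff)
      then have "int p ^ col_min J (lam ! i) dvd int p ^ col_min I' (lam ! i)"
        by (rule le_imp_power_dvd)
      moreover have "int p ^ col_min I' (lam ! i) dvd a i" "int p ^ col_min I' (lam ! i) dvd b i"
        using aI' bI' i I' by (auto simp: char_subgroup_iff)
      ultimately show ?thesis
        using i by (simp add: j_def col_min_dvd_mod) (meson dvd_diff dvd_trans)
    qed (use i in \<open>simp add: j_def a_def\<close>)
    then show ?thesis using cj J by (simp add: char_subgroup_iff)
  qed
  moreover have "b = j \<otimes>\<^bsub>A\<^esub> a"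
    using b by (auto simp: fun_eq_iff j_def mult_A mod_simps carrier_iff extensional_def)
  ultimately show "b \<in> \<Union> (subquotient_image p lam J (ideal_orbit p lam I'))"
    by (auto simp: subquotient_image_def r_coset_def)
qed

text \<open>The image is a set of right cosets, which are pairwise disjoint and all as large as the
  subgroup.\<close>

lemma card_subquotient_image:
  assumes J: "order_ideal P J" and S: "S \<subseteq> carrier A"
  shows "card (char_subgroup p lam J) * card (subquotient_image p lam J S) =
    card (\<Union> (subquotient_image p lam J S))"
proof -
  have H: "subgroup (char_subgroup p lam J) A" by (rule subgroup_char_subgroup[OF J])
  have sub: "subquotient_image p lam J S \<subseteq> rcosets\<^bsub>A\<^esub> (char_subgroup p lam J)"
    using S by (auto simp: subquotient_image_def RCOSETS_def)
  show ?thesis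
  proof (rule card_partition)
    show "finite (subquotient_image p lam J S)"
      using S finite_carrier by (auto simp: subquotient_image_def intro: finite_subset)
    have "\<Union> (subquotient_image p lam J S) \<subseteq> carrier A"
      using Union_mono[OF sub] A.rcosets_part_G[OF H] by simp
    then show "finite (\<Union> (subquotient_image p lam J S))"
      using finite_carrier by (rule finite_subset)
    show "card C = card (char_subgroup p lam J)" if "C \<in> subquotient_image p lam J S" for C
      using A.card_rcosets_equal[OF subsetD[OF sub that] subgroup.subset[OF H]] by simp
    show "C \<inter> D = {}" if "C \<in> subquotient_image p lam J S" "D \<in> subquotient_image p lam J S" "C \<noteq> D" for C D
      using pairwiseD[OF A.rcos_disjoint[OF H] subsetD[OF sub that(1)] subsetD[OF sub that(2)] that(3)]
      by (simp add: disjnt_def)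
  qed
qed

section \<open>The induced action on the subquotient\<close>

lemma auto_image_coset:
  assumes g: "g \<in> auto A" and J: "order_ideal P J" and a: "a \<in> carrier A"
  shows "g ` (char_subgroup p lam J #>\<^bsub>A\<^esub> a) = char_subgroup p lam J #>\<^bsub>A\<^esub> g a"
proof -
  have hom: "g \<in> hom A A" using g by (simp add: auto_def)
  have sub: "char_subgroup p lam J \<subseteq> carrier A" by (auto simp: char_subgroup_def)
  have "g ` char_subgroup p lam J = char_subgroup p lam J"
  \<comment> \<open>Surjectivity holds because the inverse automorphism preserves the subgroup as
    well.\<close>
  proof (intro equalityI image_subsetI subsetI)
    fix x assume x: "x \<in> char_subgroup p lam J"
    obtain g' where "g' \<in> auto A" "g (g' x) = x" using auto_inverse[OF g] x sub by (metis subsetD)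
    then show "x \<in> g ` char_subgroup p lam J"
      using hom_char_subgroup[OF _ J x, of g'] by (metis IntD1 auto_def image_eqI)
  qed (rule hom_char_subgroup[OF hom J])
  moreover have "g ` (char_subgroup p lam J #>\<^bsub>A\<^esub> a) = (g ` char_subgroup p lam J) #>\<^bsub>A\<^esub> g a"
  proof -
    have "g (h \<otimes>\<^bsub>A\<^esub> a) = g h \<otimes>\<^bsub>A\<^esub> g a" if "h \<in> char_subgroup p lam J" for h
      using hom_mult[OF hom subsetD[OF sub that] a] .
    then show ?thesis by (simp add: r_coset_def image_UN)
  qed
  ultimately show ?thesis by simp
qed

lemma subquotient_image_in_orbits:
  assumes J: "order_ideal P J" and I': "order_ideal P I'" and I: "order_ideal P I"
    and I'I: "I' \<subseteq> I"
  shows "subquotient_image p lam J (ideal_orbit p lam I') \<in>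
    orbits (AutoGroup A) (carrier (subquotient p lam I J)) (subquotient_action p lam I J)"
proof -
  let ?a = "canonical I'" and ?H = "char_subgroup p lam J"
  have a: "?a \<in> ideal_orbit p lam I'" by (rule canonical_in_ideal_orbit[OF I'])
  have ca: "?a \<in> carrier A" by (rule canonical_carrier)
  have "?a \<in> char_subgroup p lam I"
    using a I'I by (auto simp: ideal_orbit_def char_subgroup_def)
  then have C: "?H #>\<^bsub>A\<^esub> ?a \<in> carrier (subquotient p lam I J)"
    by (auto simp: subquotient_def FactGroup_def RCOSETS_def r_coset_def)
  \<comment> \<open>Invariance of ideals and transitivity together: the elements with ideal
    \<open>I'\<close> are one full orbit, with \<open>?a\<close> as base point.\<close>
  have orbit: "(\<lambda>g. g ?a) ` auto A = ideal_orbit p lam I'"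
  proof (intro equalityI image_subsetI subsetI)
    fix b assume "b \<in> ideal_orbit p lam I'"
    then show "b \<in> (\<lambda>g. g ?a) ` auto A"
      using ideal_orbit_transitive[OF a _ I'] by (auto simp: autom_equiv_def)
  next
    fix g assume "g \<in> auto A"
    then show "g ?a \<in> ideal_orbit p lam I'"
      using a by (simp add: ideal_orbit_def auto_ideal_in_of auto_carrier)
  qed
  have "subquotient_image p lam J (ideal_orbit p lam I') =
      (\<lambda>g. ?H #>\<^bsub>A\<^esub> g ?a) ` auto A"
    unfolding subquotient_image_def orbit[symmetric] by (simp only: image_image)
  also have "\<dots> = (\<lambda>g. g ` (?H #>\<^bsub>A\<^esub> ?a)) ` auto A"
    using auto_image_coset[OF _ J ca] by simp
  also have "\<dots> = orbit (AutoGroup A) (subquotient_action p lam I J) (?H #>\<^bsub>A\<^esub> ?a)"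
    using C by (auto simp: orbit_def AutoGroup_def subquotient_action_def)
  finally show ?thesis using C by (auto simp: orbits_def)
qed

end

theorem corollary9p3:
  fixes p :: nat and lam :: "nat list" and J I' I :: "(nat \<times> nat) set"
  assumes "prime p"
    and "is_partition lam"
    and "order_ideal (fund_poset_of lam) J"
    and "order_ideal (fund_poset_of lam) I'"
    and "order_ideal (fund_poset_of lam) I"
    and "J \<subseteq> I'" and "I' \<subseteq> I"
  shows "subquotient_image p lam J (ideal_orbit p lam I') \<in>
           orbits (AutoGroup (abelian_p_group p lam)) (carrier (subquotient p lam I J))
             (subquotient_action p lam I J)
       \<and> real (card (subquotient_image p lam J (ideal_orbit p lam I'))) =
           (\<Sum>I'' \<in> {I''. order_ideal (fund_poset_of lam) I'' \<and> I'' \<union> J = I'}.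
              real (card (ideal_orbit p lam I''))) / real (card (char_subgroup p lam J))"
proof -
  interpret partition_p_group p lam by unfold_locales fact
  let ?K = "{I''. order_ideal P I'' \<and> I'' \<union> J = I'}"
  let ?C = "subquotient_image p lam J (ideal_orbit p lam I')"
  have orbit_sub: "ideal_orbit p lam K \<subseteq> carrier A" for K by (auto simp: ideal_orbit_def)
  have "?K \<subseteq> Pow P" by (auto simp: order_ideal_def)
  then have "finite ?K" by (rule finite_subset) (simp add: finite_fund_poset_of)
  \<comment> \<open>An element has only one ideal, so the sets in the union are disjoint and their
    sizes add up.\<close>
  then have "card (\<Union>I''\<in>?K. ideal_orbit p lam I'') = (\<Sum>I''\<in>?K. card (ideal_orbit p lam I''))"
  proof (rule card_UN_disjoint)
    show "\<forall>K\<in>?K. finite (ideal_orbit p lam K)"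
      using orbit_sub finite_carrier finite_subset by blast
  qed (auto simp: ideal_orbit_def)
  then have "card (char_subgroup p lam J) * card ?C = (\<Sum>I''\<in>?K. card (ideal_orbit p lam I''))"
    using card_subquotient_image[OF assms(3) orbit_sub[of I']]
      Union_subquotient_image[OF assms(3,4,6)] by simp
  then have "real (card (char_subgroup p lam J)) * real (card ?C) =
      (\<Sum>I''\<in>?K. real (card (ideal_orbit p lam I'')))"
    by (simp flip: of_nat_mult of_nat_sum)
  moreover have "card (char_subgroup p lam J) \<noteq> 0"
  proof -
    have "finite (char_subgroup p lam J)"
      using finite_carrier by (rule rev_finite_subset) (auto simp: char_subgroup_def)
    moreover have "\<one>\<^bsub>A\<^esub> \<in> char_subgroup p lam J"
      using subgroup_char_subgroup[OF assms(3)] by (rule subgroup.one_closed)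
    ultimately show ?thesis by auto
  qed
  ultimately have "real (card ?C) =
      (\<Sum>I''\<in>?K. real (card (ideal_orbit p lam I''))) / real (card (char_subgroup p lam J))"
    by (simp add: field_simps)
  then show ?thesis using subquotient_image_in_orbits[OF assms(3,4,5,7)] by simp
qed

end
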